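(* Let $n,s,k \in \mathbb{N}$ with $n \geqslant \max\left\{ 2\binom{2s}{s}(k-1) + 1,\; 13k - 15 \right\}$. Then $m(n,2s,s,k) = n - 2k + 2$. Moreover, if $r \in \mathbb{N}$ with $2s < r$, then there exists $\varepsilon = \varepsilon(s,r) > 0$ such that $m(n,r,s,k) < (1-\varepsilon)n$ for every sufficiently large $n \in \mathbb{N}$.
   Context: An $r$-colouring of the complete graph $K_n$ ($n \geqslant 2$) is any function $f: E(K_n) \to [r] = \{1,\dots,r\}$. For a subgraph $H \subseteq K_n$, $c_f(H) = |f(E(H))|$ is the number of distinct colours on edges of $H$. A graph on at least $k+1$ vertices is $k$-connected if deleting any at most $k-1$ vertices leaves a connected graph. $M(f,n,r,s,k)$ is the maximum number of vertices of a $k$-connected subgraph $H \subseteq K_n$ with $c_f(H) \leqslant s$ (taken to be $0$ if no such subgraph exists), and $m(n,r,s,k) = \min_f M(f,n,r,s,k)$, the minimum over all $r$-colourings $f$ of $E(K_n)$. *)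

theory Defs
  imports Complex_Main "HOL-Library.FuncSet" "HOL-Library.Ramsey"
begin

text \<open>
  A finite simple graph is given by a vertex set \<open>V\<close> and a set \<open>E\<close> of two-element subsets of
  \<open>V\<close>.  The complete graph \<open>K\<^sub>n\<close> has vertex set \<open>{..<n}\<close>, and \<open>nsets {..<n} 2\<close> is its edge set.
\<close>

definition is_subgraph_complete :: "nat \<Rightarrow> nat set \<Rightarrow> nat set set \<Rightarrow> bool" where
  "is_subgraph_complete n V E \<longleftrightarrow> V \<subseteq> {..<n} \<and> E \<subseteq> nsets V 2"

definition graph_connected :: "'a set \<Rightarrow> 'a set set \<Rightarrow> bool" where
  "graph_connected V E \<longleftrightarrow> V \<noteq> {} \<and> (\<forall>u\<in>V. \<forall>v\<in>V. (u, v) \<in> {(x, y). {x, y} \<in> E}\<^sup>*)"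

definition edges_avoiding :: "'a set set \<Rightarrow> 'a set \<Rightarrow> 'a set set" where
  "edges_avoiding E W = {e \<in> E. e \<inter> W = {}}"

text \<open>
  Deleting at most \<open>k - 1\<close> vertices is written \<open>card W < k\<close>, which avoids truncated subtraction.
\<close>

definition k_connected :: "nat \<Rightarrow> 'a set \<Rightarrow> 'a set set \<Rightarrow> bool" where
  "k_connected k V E \<longleftrightarrow> finite V \<and> k + 1 \<le> card V \<and>
     (\<forall>W \<subseteq> V. card W < k \<longrightarrow> graph_connected (V - W) (edges_avoiding E W))"

text \<open>
  A colouring is a total function on sets of which only the values on edges of \<open>K\<^sub>n\<close> matter.
\<close>

definition colourings :: "nat \<Rightarrow> nat \<Rightarrow> (nat set \<Rightarrow> nat) set" where
  "colourings n r = nsets {..<n} 2 \<rightarrow> {1..r}"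

definition num_colours :: "(nat set \<Rightarrow> nat) \<Rightarrow> nat set set \<Rightarrow> nat" where
  "num_colours f E = card (f ` E)"

text \<open>
  The number of colours is not an argument of \<open>max_k_conn\<close>: it only constrains \<open>f\<close>.
\<close>

definition k_conn_orders :: "(nat set \<Rightarrow> nat) \<Rightarrow> nat \<Rightarrow> nat \<Rightarrow> nat \<Rightarrow> nat set" where
  "k_conn_orders f n s k =
     {card V | V E. is_subgraph_complete n V E \<and> k_connected k V E \<and> num_colours f E \<le> s}"

definition max_k_conn :: "(nat set \<Rightarrow> nat) \<Rightarrow> nat \<Rightarrow> nat \<Rightarrow> nat \<Rightarrow> nat" where
  "max_k_conn f n s k =
     (if k_conn_orders f n s k = {} then 0 else Max (k_conn_orders f n s k))"

definition min_max_k_conn :: "nat \<Rightarrow> nat \<Rightarrow> nat \<Rightarrow> nat \<Rightarrow> nat" where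
  "min_max_k_conn n r s k = Min ((\<lambda>f. max_k_conn f n s k) ` colourings n r)"

text \<open>
  The sets under \<open>Max\<close> and \<open>Min\<close> are finite, and the latter is nonempty once there is a colour.
\<close>

lemma k_conn_orders_le: "k_conn_orders f n s k \<subseteq> {..n}"
proof
  fix x assume "x \<in> k_conn_orders f n s k"
  then obtain V where "x = card V" and "V \<subseteq> {..<n}"
    unfolding k_conn_orders_def is_subgraph_complete_def by blast
  then show "x \<in> {..n}"
    using card_mono[of "{..<n}" V] by simp
qed

lemma finite_k_conn_orders: "finite (k_conn_orders f n s k)"
  by (rule finite_subset[OF k_conn_orders_le]) simp

lemma max_k_conn_le: "max_k_conn f n s k \<le> n"
proof (cases "k_conn_orders f n s k = {}")
  case False
  then have "Max (k_conn_orders f n s k) \<in> {..n}"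
    by (rule subsetD[OF k_conn_orders_le Max_in[OF finite_k_conn_orders]])
  with False show ?thesis by (simp add: max_k_conn_def)
qed (simp add: max_k_conn_def)

lemma finite_max_k_conn_image: "finite ((\<lambda>f. max_k_conn f n s k) ` colourings n r)"
  proof (rule finite_subset)
  show "(\<lambda>f. max_k_conn f n s k) ` colourings n r \<subseteq> {..n}"
    by (rule image_subsetI) (simp add: max_k_conn_le)
qed simp

lemma colourings_nonempty: "1 \<le> r \<Longrightarrow> colourings n r \<noteq> {}"
proof -
  assume "1 \<le> r"
  then have "(\<lambda>_. 1) \<in> colourings n r"
    by (simp add: colourings_def)
  then show ?thesis by blast
qed

end

theory Submission
  imports Defs
begin


text \<open>Write \<open>m = k - 1\<close>. For the lower bound with \<open>2 * s\<close> colours,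
  call the colours up to \<open>s\<close> red and the others blue. Each group has at most
  \<open>s\<close> colours, so it suffices that a red/blue complete graph on more than
  \<open>8 * m\<close> vertices contains a red or a blue \<open>(m + 1)\<close>-connected subgraph
  missing at most \<open>2 * m\<close> vertices. This is
  \<open>highly_connected_graph_or_complement\<close>.

  For the upper bounds, a vertex of a \<open>k\<close>-connected graph has degree at least
  \<open>k\<close> (\<open>k_connected_degree\<close>). If every \<open>s\<close>-set
  \<open>S\<close> of colours has a class of vertices, each with fewer than \<open>k\<close>
  neighbours in the colours of \<open>S\<close>, then a subgraph coloured from \<open>S\<close>
  misses that whole class (\<open>max_k_conn_le_if_low_degree\<close>). The colourings come from
  \<open>avoiding_colouring_exists\<close>: each edge tries to avoid the sets assigned to both of
  its ends. This fails only when the two sets together are all colours. For \<open>r = 2 * s\<close>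
  it happens between complementary classes; classes of size \<open>2 * m\<close> are then halved, so
  that each vertex sees its forbidden colours on at most \<open>m\<close> edges, and a loss of
  \<open>2 * m\<close> vertices is forced. For \<open>r > 2 * s\<close> it never happens, so the
  classes can partition all vertices and a constant fraction is lost.\<close>

section \<open>Criteria for connectivity, and minimum degree\<close>

lemma graph_connectedI:
  assumes "z \<in> V"
    and closed: "\<And>P. z \<in> P \<Longrightarrow> P \<subseteq> V \<Longrightarrow>
      (\<And>p q. p \<in> P \<Longrightarrow> q \<in> V \<Longrightarrow> {p, q} \<in> E \<Longrightarrow> q \<in> P) \<Longrightarrow> V \<subseteq> P"
  shows "graph_connected V E"
proof -
  let ?r = "{(x, y). {x, y} \<in> E}"
  \<comment> \<open>The closure hypothesis is applied to the set of vertices reachable from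
    \<open>z\<close>.\<close>
  have "V \<subseteq> {x \<in> V. (z, x) \<in> ?r\<^sup>*}"
  proof (rule closed)
    fix p q assume "p \<in> {x \<in> V. (z, x) \<in> ?r\<^sup>*}" "q \<in> V" "{p, q} \<in> E"
    then show "q \<in> {x \<in> V. (z, x) \<in> ?r\<^sup>*}"
      by (auto intro: rtrancl_into_rtrancl)
  qed (use assms(1) in auto)
  then have reach: "(z, x) \<in> ?r\<^sup>*" if "x \<in> V" for x
    using that by blast
  have "sym ?r"
    by (auto simp: sym_def insert_commute)
  then have "(x, z) \<in> ?r\<^sup>*" if "x \<in> V" for x
    using reach[OF that] by (meson sym_rtrancl symD)
  with reach show ?thesis
    unfolding graph_connected_def using assms(1) by (meson empty_iff rtrancl_trans)
qed

lemma not_graph_connectedE: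
  assumes "\<not> graph_connected V E" "V \<noteq> {}"
  obtains A C where "A \<union> C = V" "A \<inter> C = {}" "A \<noteq> {}" "C \<noteq> {}"
    "\<And>a c. a \<in> A \<Longrightarrow> c \<in> C \<Longrightarrow> {a, c} \<notin> E"
proof -
  obtain z where z: "z \<in> V" using assms(2) by blast
  obtain P where P: "z \<in> P" "P \<subseteq> V" "\<not> V \<subseteq> P"
    and "\<And>p q. p \<in> P \<Longrightarrow> q \<in> V \<Longrightarrow> {p, q} \<in> E \<Longrightarrow> q \<in> P"
    using graph_connectedI[OF z] assms(1) by metis
  then show ?thesis
    by (intro that[of P "V - P"]) auto
qed

text \<open>Connectivity after each deletion becomes a closure argument: the start \<open>z\<close>
  may depend on \<open>W\<close>, and \<open>edges_avoiding\<close> disappears because both ends of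
  the edges considered already lie outside \<open>W\<close>.\<close>

lemma k_connectedI:
  assumes "finite V" "k + 1 \<le> card V"
    and "\<And>W. W \<subseteq> V \<Longrightarrow> card W < k \<Longrightarrow> \<exists>z \<in> V - W. \<forall>P. z \<in> P \<longrightarrow> P \<subseteq> V - W \<longrightarrow>
      (\<forall>p \<in> P. \<forall>q \<in> V - W. {p, q} \<in> E \<longrightarrow> q \<in> P) \<longrightarrow> V - W \<subseteq> P"
  shows "k_connected k V E"
  unfolding k_connected_def
proof (intro conjI allI impI)
  fix W assume W: "W \<subseteq> V" "card W < k"
  from assms(3)[OF this] obtain z where z: "z \<in> V - W" and
    *: "\<And>P. z \<in> P \<Longrightarrow> P \<subseteq> V - W \<Longrightarrow>
      (\<forall>p \<in> P. \<forall>q \<in> V - W. {p, q} \<in> E \<longrightarrow> q \<in> P) \<Longrightarrow> V - W \<subseteq> P"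
    by blast
  show "graph_connected (V - W) (edges_avoiding E W)"
  proof (rule graph_connectedI[OF z])
    fix P assume P: "z \<in> P" "P \<subseteq> V - W"
      "\<And>p q. p \<in> P \<Longrightarrow> q \<in> V - W \<Longrightarrow> {p, q} \<in> edges_avoiding E W \<Longrightarrow> q \<in> P"
    show "V - W \<subseteq> P"
    proof (rule *[OF P(1,2)], intro ballI impI)
      fix p q assume pq: "p \<in> P" "q \<in> V - W" "{p, q} \<in> E"
      then show "q \<in> P"
        using P(2) by (intro P(3)[OF pq(1,2)]) (auto simp: edges_avoiding_def)
    qed
  qed
qed (use assms in auto)

lemma exists_in_Diff:
  assumes "finite W" "card W < card A"
  obtains x where "x \<in> A" "x \<notin> W"
  using assms card_mono[of W A] by (metis not_less subsetI)

text \<open>Deleting the neighbourhood of \<open>v\<close> isolates \<open>v\<close>. If that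
  neighbourhood had fewer than \<open>k\<close> vertices, the bound
  \<open>k + 1 \<le> card V\<close> would leave another vertex, and the deletion would disconnect
  the graph.\<close>

lemma k_connected_degree:
  assumes "k_connected k V E" "v \<in> V" "E \<subseteq> nsets V 2"
  shows "k \<le> card {y \<in> V. {v, y} \<in> E}"
proof (rule ccontr)
  let ?W = "{y \<in> V. {v, y} \<in> E}"
  assume less: "\<not> k \<le> card ?W"
  have fin: "finite V" and card: "k + 1 \<le> card V"
    and conn: "graph_connected (V - ?W) (edges_avoiding E ?W)"
    using assms(1) less unfolding k_connected_def by auto
  have "{v} \<notin> E" using assms(3) by (auto simp: nsets_def)
  then have v: "v \<in> V - ?W" using assms(2) by auto
  have "card (insert v ?W) < card V"
    using less card card_insert_le_m1[of "card V" ?W v] fin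
    by (simp add: card_insert_if)
  then obtain u where u: "u \<in> V" "u \<notin> insert v ?W"
    using exists_in_Diff[of "insert v ?W" V] fin by auto
  then have "(v, u) \<in> {(x, y). {x, y} \<in> edges_avoiding E ?W}\<^sup>*"
    using conn v unfolding graph_connected_def by auto
  \<comment> \<open>The first edge of a path from \<open>v\<close> to \<open>u\<close> leads to a
    neighbour of \<open>v\<close> that was not deleted.\<close>
  then obtain y where y: "{v, y} \<in> edges_avoiding E ?W"
    using u by (auto elim: converse_rtranclE)
  then have "{v, y} \<subseteq> V" using assms(3) by (auto simp: edges_avoiding_def nsets_def)
  then have "y \<in> V" by simp
  with y show False by (auto simp: edges_avoiding_def)
qed

section \<open>A graph or its complement has a large highly connected subgraph\<close>

text \<open>Double counting of the pairs with \<open>Q u x\<close>: each \<open>u\<close> lies in at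
  most \<open>m\<close> of them, while each \<open>x\<close> in the set to be bounded lies in at
  least \<open>card U - m\<close>, which exceeds \<open>m\<close>. Here \<open>Q\<close> will be red
  adjacency, and the lemma bounds the vertices with few blue neighbours in \<open>U\<close>.\<close>

lemma few_low_degree_vertices:
  assumes fin: "finite U" "finite N"
    and miss: "\<And>u. u \<in> U \<Longrightarrow> card {x \<in> N. Q u x} \<le> m"
    and U: "2 * m < card U"
  shows "card {x \<in> N. card {u \<in> U. \<not> Q u x} \<le> m} \<le> 2 * m"
proof (rule ccontr)
  let ?D = "{x \<in> N. card {u \<in> U. \<not> Q u x} \<le> m}"
  assume many: "\<not> card ?D \<le> 2 * m"
  define t where "t = card U - m"
  have t: "card U = m + t" "m < t" using U by (simp_all add: t_def)
  have "t \<le> card {u \<in> U. Q u x}" if "x \<in> ?D" for x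
  proof -
    have "card {u \<in> U. Q u x} + card {u \<in> U. \<not> Q u x}
        = card ({u \<in> U. Q u x} \<union> {u \<in> U. \<not> Q u x})"
      using fin by (intro card_Un_disjoint[symmetric]) auto
    also have "{u \<in> U. Q u x} \<union> {u \<in> U. \<not> Q u x} = U" by auto
    finally show ?thesis using that t by simp
  qed
  then have "card ?D * t \<le> (\<Sum>x\<in>?D. card {u \<in> U. Q u x})"
    using sum_bounded_below[of ?D t] by simp
  also have "\<dots> \<le> (\<Sum>x\<in>N. card {u \<in> U. Q u x})"
    using fin by (intro sum_mono2) auto
  also have "\<dots> = (\<Sum>x\<in>N. \<Sum>u\<in>U. if Q u x then 1 else 0)"
    using fin by (simp flip: sum.inter_filter)
  also have "\<dots> = (\<Sum>u\<in>U. \<Sum>x\<in>N. if Q u x then 1 else 0)"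
    by (rule sum.swap)
  also have "\<dots> = (\<Sum>u\<in>U. card {x \<in> N. Q u x})"
    using fin by (simp flip: sum.inter_filter)
  also have "\<dots> \<le> card U * m"
    using sum_bounded_above[of U _ m] miss by simp
  finally have "card ?D * t \<le> (m + t) * m" using t by simp
  moreover have "(2 * m + 1) * t \<le> card ?D * t"
    using many by (intro mult_right_mono) auto
  ultimately have "(2 * m + 1) * t \<le> (m + t) * m" by linarith
  then have "(m + 1) * t \<le> m * m" by (simp add: algebra_simps)
  moreover have "m * m \<le> m * t" using t by simp
  ultimately show False using t by simp
qed

text \<open>
  Think of \<open>R\<close> as the red edges.  Splitting off small sides of red separators one after another
  leaves a set \<open>U\<close> whose vertices have few red neighbours outside.  Either the red graph on the
  rest becomes highly connected, or a balanced separator or the set \<open>U\<close> itself yields a large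
  blue graph that is almost complete bipartite.
\<close>

theorem highly_connected_graph_or_complement:
  fixes V :: "'a set" and R :: "'a set set" and m :: nat
  assumes fin: "finite V" and card_V: "m + 2 \<le> card V" "8 * m < card V"
  obtains X where "X \<subseteq> V" "card V \<le> card X + 2 * m"
    "k_connected (Suc m) X (nsets X 2 \<inter> R) \<or> k_connected (Suc m) X (nsets X 2 - R)"
proof -
  define red where "red U u = {x \<in> V - U. {u, x} \<in> R}" for U u
  \<comment> \<open>The bound \<open>3 * m\<close> leaves room to add a side of at most
    \<open>m\<close> vertices while \<open>card U \<le> 2 * m\<close>, and it guarantees that a
    largest such set exists.\<close>
  define ok where "ok U \<longleftrightarrow> U \<subseteq> V \<and> card U \<le> 3 * m \<and> (\<forall>u \<in> U. card (red U u) \<le> m)" for U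
  have "ok {}" by (simp add: ok_def)
  moreover have "\<forall>U. ok U \<longrightarrow> card U < Suc (3 * m)" by (simp add: ok_def)
  ultimately obtain U where U: "ok U" and max: "\<And>U'. ok U' \<Longrightarrow> card U' \<le> card U"
    using ex_has_greatest_nat[of ok "{}" card "Suc (3 * m)"] by blast
  have UV: "U \<subseteq> V" and card_U: "card U \<le> 3 * m"
    and red_U: "\<And>u. u \<in> U \<Longrightarrow> card (red U u) \<le> m"
    using U by (auto simp: ok_def)
  have fin_red: "finite (red U u)" for U u using fin by (simp add: red_def)
  have finU: "finite U" using fin UV by (rule finite_subset[rotated])
  let ?N = "V - U"
  have card_N: "card ?N = card V - card U"
    using UV finU by (simp add: card_Diff_subset)
  show thesis
  proof (cases "card U \<le> 2 * m")
    case True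
    show thesis
    proof (cases "k_connected (Suc m) ?N (nsets ?N 2 \<inter> R)")
      case True
      then show thesis using card_N \<open>card U \<le> 2 * m\<close> by (intro that[of ?N]) auto
    next
      case False
      have "m + 2 \<le> card ?N" using card_N True card_V by linarith
      with False obtain W where W: "W \<subseteq> ?N" "card W \<le> m"
        and disc: "\<not> graph_connected (?N - W) (edges_avoiding (nsets ?N 2 \<inter> R) W)"
        using fin unfolding k_connected_def by auto
      have finW: "finite W" using W(1) fin by (meson finite_Diff finite_subset)
      have card_NW: "card (?N - W) = card ?N - card W"
        using W finW by (simp add: card_Diff_subset)
      then have "?N - W \<noteq> {}" using \<open>m + 2 \<le> card ?N\<close> W by (metis card.empty add_2_eq_Suc'
            diff_is_0_eq not_less_eq_eq le_SucI order_trans)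
      with disc obtain A C where AC: "A \<union> C = ?N - W" "A \<inter> C = {}" "A \<noteq> {}" "C \<noteq> {}"
        and *: "\<And>a c. a \<in> A \<Longrightarrow> c \<in> C \<Longrightarrow> {a, c} \<notin> edges_avoiding (nsets ?N 2 \<inter> R) W"
        by (rule not_graph_connectedE) blast
      have blue: "{a, c} \<notin> R" "{c, a} \<notin> R" if "a \<in> A" "c \<in> C" for a c
      proof -
        have "a \<in> ?N - W" "c \<in> ?N - W" "a \<noteq> c" using AC that by auto
        then show "{a, c} \<notin> R" using *[OF that]
          by (auto simp: edges_avoiding_def)
        then show "{c, a} \<notin> R" by (simp add: insert_commute)
      qed
      have fAC: "finite A" "finite C" using AC(1) fin by (metis finite_Diff finite_Un)+
      \<comment> \<open>A side with at most \<open>m\<close> vertices could be moved into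
        \<open>U\<close>, since its red neighbours outside the enlarged set all lie in the separator
        \<open>W\<close>; this contradicts maximality. The claim is stated for either side.\<close>
      have large: "m < card A'"
        if A': "A' \<union> C' = ?N - W" "A' \<inter> C' = {}" "A' \<noteq> {}"
          and blue': "\<And>a c. a \<in> A' \<Longrightarrow> c \<in> C' \<Longrightarrow> {a, c} \<notin> R" for A' C'
      proof (rule ccontr)
        assume small: "\<not> m < card A'"
        have finA': "finite A'" using A'(1) fin by (metis finite_Diff finite_Un)
        have disj: "A' \<inter> U = {}" using A'(1) by auto
        have "card (U \<union> A') = card U + card A'"
          using finU finA' disj by (simp add: card_Un_disjoint Int_commute)
        moreover have "card A' > 0" using A'(3) finA' by (simp add: card_gt_0_iff)
        moreover have "ok (U \<union> A')"
          unfolding ok_def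
        proof (intro conjI ballI)
          show "U \<union> A' \<subseteq> V" using UV A'(1) by auto
          show "card (U \<union> A') \<le> 3 * m" using calculation small True by linarith
        next
          fix u assume "u \<in> U \<union> A'"
          then consider "u \<in> U" | "u \<in> A'" by blast
          then show "card (red (U \<union> A') u) \<le> m"
          proof cases
            case 1
            have "card (red (U \<union> A') u) \<le> card (red U u)"
              by (rule card_mono[OF fin_red]) (auto simp: red_def)
            then show ?thesis using red_U[OF 1] by simp
          next
            case 2
            have "red (U \<union> A') u \<subseteq> W"
              using A'(1) blue'[OF 2] by (auto simp: red_def)
            then have "card (red (U \<union> A') u) \<le> card W" by (rule card_mono[OF finW])
            then show ?thesis using W(2) by simp
          qed
        qed
        ultimately show False using max[of "U \<union> A'"] by simp
      qed
      have big: "m < card A" "m < card C"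
        using large[of A C] large[of C A] AC blue by (auto simp: Un_commute Int_commute)
      \<comment> \<open>Only the separator is dropped. In blue, \<open>A\<close> and
        \<open>C\<close> are completely joined, so deleting \<open>m\<close> vertices keeps what is
        left of them connected; the vertices of \<open>U\<close> attach to them.\<close>
      define X where "X = A \<union> C \<union> U"
      have X: "X = V - W" using AC(1) UV W(1) by (auto simp: X_def)
      have card_X: "card X = card V - card W"
        using W(1) finW by (simp add: X card_Diff_subset subset_iff)
      have card_AC: "card V \<le> card (A \<union> C) + 3 * m"
        using card_NW card_N True W(2) AC(1) by simp
      have "k_connected (Suc m) X (nsets X 2 - R)"
      proof (rule k_connectedI)
        show "finite X" using fin by (simp add: X)
        show "Suc m + 1 \<le> card X"
        proof -
          have "card (A \<union> C) \<le> card X" using \<open>finite X\<close> by (intro card_mono) (auto simp: X_def)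
          moreover have "card (A \<union> C) = card A + card C"
            using fAC AC(2) by (rule card_Un_disjoint)
          moreover have "card A > m" "card C > m" by (fact big)+
          ultimately show ?thesis by linarith
        qed
        fix Z assume Z: "Z \<subseteq> X" "card Z < Suc m"
        have finZ: "finite Z" using Z(1) \<open>finite X\<close> by (rule finite_subset)
        obtain a where a: "a \<in> A" "a \<notin> Z"
          using exists_in_Diff[of Z A] finZ Z big by auto
        obtain c where c: "c \<in> C" "c \<notin> Z"
          using exists_in_Diff[of Z C] finZ Z big by auto
        show "\<exists>z \<in> X - Z. \<forall>P. z \<in> P \<longrightarrow> P \<subseteq> X - Z \<longrightarrow>
          (\<forall>p \<in> P. \<forall>q \<in> X - Z. {p, q} \<in> nsets X 2 - R \<longrightarrow> q \<in> P) \<longrightarrow> X - Z \<subseteq> P"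
        proof (intro bexI[of _ a] allI impI)
          show "a \<in> X - Z" using a by (simp add: X_def)
          fix P assume P: "a \<in> P" "P \<subseteq> X - Z"
            and closed: "\<forall>p \<in> P. \<forall>q \<in> X - Z. {p, q} \<in> nsets X 2 - R \<longrightarrow> q \<in> P"
          have step: "q \<in> P" if "p \<in> P" "q \<in> X - Z" "p \<noteq> q" "{p, q} \<notin> R" for p q
            using closed that P(2) by (auto)
          have CP: "C - Z \<subseteq> P"
          proof
            fix q assume "q \<in> C - Z"
            then show "q \<in> P" using step[OF P(1), of q] a AC(2) blue by (auto simp: X_def)
          qed
          have AP: "A - Z \<subseteq> P"
          proof
            fix q assume "q \<in> A - Z"
            then show "q \<in> P" using step[of c q] c CP AC(2) blue by (auto simp: X_def)
          qed
          have "U - Z \<subseteq> P"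
          proof
            fix u assume u: "u \<in> U - Z"
            \<comment> \<open>At most \<open>2 * m\<close> vertices are excluded, while
              \<open>A \<union> C\<close> has more than \<open>5 * m\<close>.\<close>
            have "card (Z \<union> red U u) \<le> card Z + card (red U u)" by (rule card_Un_le)
            also have "\<dots> < card (A \<union> C)"
              using Z red_U[of u] u card_AC card_V(2) by auto
            finally obtain w where w: "w \<in> A \<union> C" "w \<notin> Z \<union> red U u"
              using exists_in_Diff[of "Z \<union> red U u" "A \<union> C"] finZ fin_red by auto
            have "w \<in> V" "w \<notin> U" using w(1) AC(1) by auto
            then have "{u, w} \<notin> R" using w(2) by (auto simp: red_def)
            then show "u \<in> P"
              using step[of w u] w u AP CP \<open>w \<notin> U\<close> by (auto simp: X_def insert_commute)
          qed
          with AP CP show "X - Z \<subseteq> P" by (auto simp: X_def)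
        qed
      qed
      then show thesis using card_X W(2) by (intro that[of X]) (auto simp: X)
    qed
  next
    case False
    \<comment> \<open>Now \<open>2 * m < card U\<close>, so \<open>U\<close> serves as a core for
      the blue graph. The vertices outside \<open>U\<close> with at most \<open>m\<close> blue
      neighbours in the core are discarded.\<close>
    define D where "D = {x \<in> ?N. card {u \<in> U. {u, x} \<notin> R} \<le> m}"
    have finD: "finite D" using fin by (simp add: D_def)
    have card_D: "card D \<le> 2 * m"
      unfolding D_def
    proof (rule few_low_degree_vertices)
      fix u assume "u \<in> U"
      then show "card {x \<in> ?N. {u, x} \<in> R} \<le> m" using red_U by (simp add: red_def)
    qed (use fin finU False in auto)
    define X where "X = V - D"
    have card_X: "card X = card V - card D"
      unfolding X_def using finD by (intro card_Diff_subset) (auto simp: D_def)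
    have UX: "U \<subseteq> X" using UV by (auto simp: X_def D_def)
    have "m > 0" using False card_U by auto
    have "k_connected (Suc m) X (nsets X 2 - R)"
    proof (rule k_connectedI)
      show finX: "finite X" using fin by (simp add: X_def)
      show "Suc m + 1 \<le> card X" using card_X card_D card_V \<open>m > 0\<close> by linarith
      fix Z assume Z: "Z \<subseteq> X" "card Z < Suc m"
      have finZ: "finite Z" using Z(1) finX by (rule finite_subset)
      obtain z where z: "z \<in> U" "z \<notin> Z"
        using exists_in_Diff[of Z U] finZ Z False by auto
      show "\<exists>z \<in> X - Z. \<forall>P. z \<in> P \<longrightarrow> P \<subseteq> X - Z \<longrightarrow>
        (\<forall>p \<in> P. \<forall>q \<in> X - Z. {p, q} \<in> nsets X 2 - R \<longrightarrow> q \<in> P) \<longrightarrow> X - Z \<subseteq> P"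
      proof (intro bexI[of _ z] allI impI)
        show "z \<in> X - Z" using z UX by auto
        fix P assume P: "z \<in> P" "P \<subseteq> X - Z"
          and closed: "\<forall>p \<in> P. \<forall>q \<in> X - Z. {p, q} \<in> nsets X 2 - R \<longrightarrow> q \<in> P"
        have step: "q \<in> P" if "p \<in> P" "q \<in> X - Z" "p \<noteq> q" "{p, q} \<notin> R" for p q
          using closed that P(2) by (auto)
        have UP: "U - Z \<subseteq> P"
        proof
          fix u assume u: "u \<in> U - Z"
          \<comment> \<open>A common blue neighbour of \<open>u\<close> and \<open>z\<close> is
            sought outside \<open>U\<close>. At most \<open>2 * m + m + m + m = 5 * m\<close>
            vertices are excluded, and \<open>card ?N > 8 * m - 3 * m\<close>.\<close>
          let ?F = "D \<union> Z \<union> red U u \<union> red U z"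
          have "card ?F \<le> card D + card Z + card (red U u) + card (red U z)"
            using card_Un_le[of "D \<union> Z \<union> red U u" "red U z"]
              card_Un_le[of "D \<union> Z" "red U u"] card_Un_le[of D Z] by linarith
          also have "\<dots> < card ?N"
            using card_D Z red_U[of u] red_U[OF z(1)] u card_N card_U card_V(2)
            by auto
          finally obtain w where w: "w \<in> ?N" "w \<notin> ?F"
            using exists_in_Diff[of ?F ?N] finD finZ fin_red by auto
          then have "{z, w} \<notin> R" "{w, u} \<notin> R" "w \<in> X - Z" "w \<noteq> z" "w \<noteq> u"
            using z u by (auto simp: red_def X_def insert_commute)
          then have "w \<in> P" using step[OF P(1)] by auto
          then show "u \<in> P" using step[of w u] u UX \<open>{w, u} \<notin> R\<close> \<open>w \<noteq> u\<close> by auto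
        qed
        show "X - Z \<subseteq> P"
        proof
          fix x assume x: "x \<in> X - Z"
          show "x \<in> P"
          proof (cases "x \<in> U")
            case True
            then show ?thesis using UP x by auto
          next
            case False
            \<comment> \<open>A retained vertex outside \<open>U\<close> has more than
              \<open>m\<close> blue neighbours in \<open>U\<close>, and \<open>Z\<close> cannot
              contain them all.\<close>
            then have "m < card {u \<in> U. {u, x} \<notin> R}" using x by (auto simp: X_def D_def)
            then obtain u where u: "u \<in> U" "{u, x} \<notin> R" "u \<notin> Z"
              using exists_in_Diff[of Z "{u \<in> U. {u, x} \<notin> R}"] finZ Z by auto
            then show ?thesis using step[of u x] UP x False by auto
          qed
        qed
      qed
    qed
    then show thesis using card_X card_D by (intro that[of X]) (auto simp: X_def)
  qed
qed


section \<open>The lower bound for \<open>2 * s\<close> colours\<close>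

lemma max_k_conn_ge:
  assumes "is_subgraph_complete n V E" "k_connected k V E" "num_colours f E \<le> s"
  shows "card V \<le> max_k_conn f n s k"
proof -
  have "card V \<in> k_conn_orders f n s k"
    unfolding k_conn_orders_def using assms by blast
  then show ?thesis
    unfolding max_k_conn_def using finite_k_conn_orders by auto
qed

lemma num_colours_le:
  assumes "f ` E \<subseteq> S" "finite S" "card S = s"
  shows "num_colours f E \<le> s"
  using card_mono[OF assms(2,1)] assms(3) by (simp add: num_colours_def)

lemma max_k_conn_two_s_ge:
  assumes f: "f \<in> colourings n (2 * s)"
    and n: "m + 2 \<le> n" "8 * m < n"
  shows "n \<le> max_k_conn f n s (Suc m) + 2 * m"
proof -
  obtain X where X: "X \<subseteq> {..<n}" "n \<le> card X + 2 * m"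
    and conn: "k_connected (Suc m) X (nsets X 2 \<inter> {e. f e \<le> s})
      \<or> k_connected (Suc m) X (nsets X 2 - {e. f e \<le> s})"
    using highly_connected_graph_or_complement[of "{..<n}" m "{e. f e \<le> s}"] n by auto
  have col: "f e \<in> {1..2 * s}" if "e \<in> nsets X 2" for e
    using f nsets_mono[OF X(1)] that unfolding colourings_def by blast
  have low: "num_colours f (nsets X 2 \<inter> {e. f e \<le> s}) \<le> s"
    by (rule num_colours_le[where S = "{1..s}"]) (auto dest: col)
  have high: "num_colours f (nsets X 2 - {e. f e \<le> s}) \<le> s"
    by (rule num_colours_le[where S = "{s+1..2*s}"]) (auto dest: col)
  have "card X \<le> max_k_conn f n s (Suc m)"
    using conn
  proof
    assume "k_connected (Suc m) X (nsets X 2 \<inter> {e. f e \<le> s})"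
    then show ?thesis using low X(1)
      by (intro max_k_conn_ge) (auto simp: is_subgraph_complete_def)
  next
    assume "k_connected (Suc m) X (nsets X 2 - {e. f e \<le> s})"
    then show ?thesis using high X(1)
      by (intro max_k_conn_ge) (auto simp: is_subgraph_complete_def)
  qed
  then show ?thesis using X(2) by simp
qed

section \<open>Upper bounds from colourings with low-degree classes\<close>

text \<open>The colours of a largest admissible subgraph extend to a set \<open>S\<close> of exactly
  \<open>s\<close> colours. Its vertices have at least \<open>k\<close> neighbours in the colours of
  \<open>S\<close>, so none of them lies in the set \<open>X\<close> belonging to
  \<open>S\<close>.\<close>

lemma max_k_conn_le_if_low_degree:
  assumes f: "f \<in> colourings n r" and "s \<le> r"
    and low: "\<And>S. S \<in> nsets {1..r} s \<Longrightarrow> \<exists>X \<subseteq> {..<n}. t \<le> card X \<and>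
      (\<forall>x \<in> X. card {y \<in> {..<n}. x \<noteq> y \<and> f {x, y} \<in> S} < k)"
  shows "max_k_conn f n s k \<le> n - t"
proof (cases "k_conn_orders f n s k = {}")
  case False
  then have "max_k_conn f n s k \<in> k_conn_orders f n s k"
    using Max_in[OF finite_k_conn_orders] by (simp add: max_k_conn_def)
  then obtain V E where max: "max_k_conn f n s k = card V"
    and V: "V \<subseteq> {..<n}" and E: "E \<subseteq> nsets V 2"
    and conn: "k_connected k V E" and few: "card (f ` E) \<le> s"
    unfolding k_conn_orders_def is_subgraph_complete_def num_colours_def by blast
  have "f ` E \<subseteq> {1..r}"
  proof (rule image_subsetI)
    fix e assume "e \<in> E"
    then have "e \<in> nsets {..<n} 2" using E nsets_mono[OF V] by (meson subsetD)
    then show "f e \<in> {1..r}" using f unfolding colourings_def by (rule funcset_mem[rotated])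
  qed
  then obtain S where S: "f ` E \<subseteq> S" "S \<subseteq> {1..r}" "card S = s"
    using exists_subset_between[OF few, of "{1..r}"] \<open>s \<le> r\<close>
    by (metis card_atLeastAtMost diff_Suc_1 finite_atLeastAtMost)
  have "S \<in> nsets {1..r} s"
    using S(2,3) finite_subset[OF S(2)] by (simp add: nsets_def)
  from low[OF this] obtain X where X: "X \<subseteq> {..<n}" "t \<le> card X"
    and deg: "\<And>x. x \<in> X \<Longrightarrow> card {y \<in> {..<n}. x \<noteq> y \<and> f {x, y} \<in> S} < k"
    by (elim exE conjE) (rule that, assumption+, erule (1) bspec)
  have "V \<subseteq> {..<n} - X"
  proof
    fix x assume x: "x \<in> V"
    have "k \<le> card {y \<in> V. {x, y} \<in> E}"
      by (rule k_connected_degree[OF conn x E])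
    also have "\<dots> \<le> card {y \<in> {..<n}. x \<noteq> y \<and> f {x, y} \<in> S}"
    proof (rule card_mono)
      show "{y \<in> V. {x, y} \<in> E} \<subseteq> {y \<in> {..<n}. x \<noteq> y \<and> f {x, y} \<in> S}"
      proof clarify
        fix y assume "y \<in> V" "{x, y} \<in> E"
        moreover from this have "{x, y} \<in> nsets V 2" using E by blast
        ultimately show "y \<in> {..<n} \<and> x \<noteq> y \<and> f {x, y} \<in> S" using V S(1) by auto
      qed
    qed simp
    finally have "x \<notin> X" using deg[of x] by linarith
    then show "x \<in> {..<n} - X" using x V by blast
  qed
  then have "card V \<le> card ({..<n} - X)" by (intro card_mono) auto
  also have "\<dots> = n - card X" using X(1) by (simp add: card_Diff_subset finite_subset)
  finally show ?thesis using max X(2) by simp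
qed (simp add: max_k_conn_def)

lemma min_max_k_conn_le:
  assumes "f \<in> colourings n r"
  shows "min_max_k_conn n r s k \<le> max_k_conn f n s k"
  unfolding min_max_k_conn_def using assms finite_max_k_conn_image by (intro Min_le) auto

text \<open>
  Each vertex \<open>x\<close> should avoid the colours in \<open>c x\<close>.  Two vertices obstruct each other only if
  their classes are complementary (which needs \<open>r = 2 * s\<close>); then \<open>p\<close> halves both classes, and
  the pair of halves decides which of the two vertices yields, so that each vertex meets its
  forbidden colours in one half of the opposite class only.  The test \<open>1 \<in> c x\<close> makes this rule
  symmetric in \<open>x\<close> and \<open>y\<close>.
\<close>

lemma avoiding_colouring_exists:
  fixes c :: "nat \<Rightarrow> nat set" and p :: "nat \<Rightarrow> bool"
  assumes s: "1 \<le> s" "2 * s \<le> r"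
    and c: "\<And>x. c x \<subseteq> {1..r}" "\<And>x. card (c x) \<le> s"
  obtains f where "f \<in> colourings n r"
    "\<And>x y. x \<noteq> y \<Longrightarrow> f {x, y} \<in> c x \<Longrightarrow>
      c x \<union> c y = {1..r} \<and> (p x = p y \<longleftrightarrow> 1 \<in> c x)"
proof -
  define Q where "Q x y a \<longleftrightarrow> a \<in> {1..r} \<and>
    (if c x \<union> c y = {1..r} then a \<in> c x \<longleftrightarrow> ((p x = p y) = (1 \<in> c x)) else a \<notin> c x \<union> c y)"
    for x y a
  have fin: "finite (c x)" for x using c(1) by (rule finite_subset) simp
  \<comment> \<open>Two sets of size at most \<open>s\<close> can cover \<open>r \<ge> 2 * s\<close>
    colours only if they are disjoint and of size exactly \<open>s\<close>.\<close>
  have compl: "c x \<inter> c y = {} \<and> card (c x) = s" if "c x \<union> c y = {1..r}" for x y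
  proof -
    have "card (c x) + card (c y) = r + card (c x \<inter> c y)"
      using card_Un_Int[OF fin fin, of x y] that by simp
    then have "card (c x \<inter> c y) = 0" "card (c x) = s"
      using s(2) c(2)[of x] c(2)[of y] by linarith+
    then show ?thesis using fin by simp
  qed
  have Q_ex: "\<exists>a. Q x y a" for x y
  proof (cases "c x \<union> c y = {1..r}")
    case True
    then have "c x \<noteq> {}" "c y \<noteq> {}" "c x \<inter> c y = {}"
      using compl[of x y] compl[of y x] s(1) by (auto simp: Un_commute)
    then obtain a b where "a \<in> c x" "b \<in> c y" "b \<notin> c x" by blast
    moreover from this have "a \<in> {1..r}" "b \<in> {1..r}" using c(1) by blast+
    ultimately have "Q x y a \<or> Q x y b" using True unfolding Q_def by auto
    then show ?thesis by blast
  next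
    case False
    moreover have "c x \<union> c y \<subseteq> {1..r}" using c(1) by blast
    ultimately obtain a where "a \<in> {1..r}" "a \<notin> c x \<union> c y" by blast
    then show ?thesis using False unfolding Q_def by auto
  qed
  \<comment> \<open>In the complementary case, exchanging \<open>x\<close> and \<open>y\<close>
    negates both \<open>a \<in> c x\<close> and \<open>1 \<in> c x\<close>, so the equivalence is
    preserved.\<close>
  have Q_sym: "Q y x a" if "Q x y a" for x y a
  proof (cases "c x \<union> c y = {1..r}")
    case True
    have *: "b \<in> c y \<longleftrightarrow> b \<notin> c x" if "b \<in> {1..r}" for b
      using True compl[OF True] that by blast
    have "a \<in> {1..r}" "1 \<in> {1..r}" using that s by (auto simp: Q_def)
    then have "a \<in> c y \<longleftrightarrow> a \<notin> c x" "1 \<in> c y \<longleftrightarrow> 1 \<notin> c x" by (simp_all only: *)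
    then show ?thesis using that True unfolding Q_def
      by (simp add: Un_commute[of "c y" "c x"] eq_commute[of "p y" "p x"])
  next
    case False
    then show ?thesis using that unfolding Q_def by (simp add: Un_commute[of "c y" "c x"])
  qed
  \<comment> \<open>\<open>Min\<close> and \<open>Max\<close> order the two ends of an edge; by
    \<open>Q_sym\<close> the chosen colour is also right for the opposite order.\<close>
  define f where "f e = (SOME a. Q (Min e) (Max e) a)" for e :: "nat set"
  have Q_SOME: "Q (Min e) (Max e) (f e)" for e
    unfolding f_def using Q_ex by (rule someI_ex)
  have Q_f: "Q x y (f {x, y})" for x y
  proof (cases "x \<le> y")
    case True
    then show ?thesis using Q_SOME[of "{x, y}"] by simp
  next
    case False
    then show ?thesis using Q_SOME[of "{x, y}"] by (intro Q_sym[of y x]) simp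
  qed
  show thesis
  proof (rule that)
    show "f \<in> colourings n r"
      unfolding colourings_def
    proof
      fix e :: "nat set"
      show "f e \<in> {1..r}" using Q_SOME[of e] by (simp add: Q_def)
    qed
    fix x y assume "x \<noteq> y" "f {x, y} \<in> c x"
    then show "c x \<union> c y = {1..r} \<and> (p x = p y \<longleftrightarrow> 1 \<in> c x)"
      using Q_f[of x y] unfolding Q_def by (auto split: if_splits)
  qed
qed

lemma obtain_nsets_enumeration:
  obtains h where "inj_on h {..<r choose s}"
    "\<And>i. i < r choose s \<Longrightarrow> h i \<in> nsets {1..r} s"
    "\<And>S. S \<in> nsets {1..r} s \<Longrightarrow> \<exists>i < r choose s. h i = S"
proof -
  have "card (nsets {1..r} s) = r choose s"
    using n_subsets[of "{1..r}" s] by (simp add: nsets_def finite_subset conj_commute cong: conj_cong)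
  then obtain h where h: "bij_betw h {..<r choose s} (nsets {1..r} s)"
    using ex_bij_betw_nat_finite[OF finite_imp_finite_nsets[of "{1..r}" s]]
    by (auto simp: atLeast0LessThan)
  show thesis
  proof (rule that)
    show "inj_on h {..<r choose s}" using h by (rule bij_betw_imp_inj_on)
    fix i assume "i < r choose s"
    then show "h i \<in> nsets {1..r} s" using bij_betwE[OF h] by blast
  next
    fix S assume "S \<in> nsets {1..r} s"
    then have "S \<in> h ` {..<r choose s}" by (simp only: bij_betw_imp_surj_on[OF h])
    then show "\<exists>i < r choose s. h i = S" by blast
  qed
qed

text \<open>Each \<open>s\<close>-set \<open>S\<close> of colours receives a block of
  \<open>2 * m\<close> vertices. A vertex of that block meets colours of \<open>S\<close> only
  towards one half of the block of the complementary set, hence on at most \<open>m\<close>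
  edges.\<close>

lemma min_max_k_conn_two_s_le:
  assumes s: "1 \<le> s" and m: "0 < m" and n: "2 * m * ((2 * s) choose s) \<le> n"
  shows "min_max_k_conn n (2 * s) s (Suc m) \<le> n - 2 * m"
proof -
  let ?C = "(2 * s) choose s"
  obtain h where h: "inj_on h {..<?C}" "\<And>i. i < ?C \<Longrightarrow> h i \<in> nsets {1..2 * s} s"
    "\<And>S. S \<in> nsets {1..2 * s} s \<Longrightarrow> \<exists>i < ?C. h i = S"
    by (rule obtain_nsets_enumeration) blast
  have h_in: "h i \<subseteq> {1..2 * s}" "card (h i) = s" if "i < ?C" for i
    using h(2)[OF that] by (auto simp: nsets_def)
  \<comment> \<open>The blocks are consecutive intervals; vertices beyond the last block avoid
    nothing. The predicate \<open>p\<close> marks the first half of each block.\<close>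
  define c where "c v = (if v div (2 * m) < ?C then h (v div (2 * m)) else {})" for v
  define p where "p v \<longleftrightarrow> v mod (2 * m) < m" for v
  have c: "c v \<subseteq> {1..2 * s}" "card (c v) \<le> s" for v
    using h_in by (simp_all add: c_def)
  have fin_c: "finite (c v)" for v using c(1) by (rule finite_subset) simp
  obtain f where f: "f \<in> colourings n (2 * s)"
    and f_c: "\<And>x y. x \<noteq> y \<Longrightarrow> f {x, y} \<in> c x \<Longrightarrow>
      c x \<union> c y = {1..2 * s} \<and> (p x = p y \<longleftrightarrow> 1 \<in> c x)"
    by (rule avoiding_colouring_exists[OF s order_refl, where c = c and p = p and n = n, OF c]) blast
  have "max_k_conn f n s (Suc m) \<le> n - 2 * m"
  proof (rule max_k_conn_le_if_low_degree[OF f])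
    fix S assume S: "S \<in> nsets {1..2 * s} s"
    obtain i where i: "i < ?C" "h i = S" using h(3)[OF S] by blast
    have card_S: "card S = s" and finS: "finite S" using S by (auto simp: nsets_def)
    have Sc: "{1..2 * s} - S \<in> nsets {1..2 * s} s"
      using S by (auto simp: nsets_def card_Diff_subset)
    obtain j where j: "j < ?C" "h j = {1..2 * s} - S" using h(3)[OF Sc] by blast
    let ?X = "{2 * m * i..<2 * m * i + 2 * m}"
    show "\<exists>X \<subseteq> {..<n}. 2 * m \<le> card X \<and>
      (\<forall>x \<in> X. card {y \<in> {..<n}. x \<noteq> y \<and> f {x, y} \<in> S} < Suc m)"
    proof (intro exI[of _ ?X] conjI ballI)
      have "2 * m * (i + 1) \<le> 2 * m * ?C" using i(1) by (intro mult_left_mono) auto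
      then show "?X \<subseteq> {..<n}" using n by auto
      show "2 * m \<le> card ?X" by simp
      fix x assume "x \<in> ?X"
      then have "x div (2 * m) = i"
        by (intro div_nat_eqI) (auto simp: algebra_simps)
      then have cx: "c x = S" using i by (simp add: c_def)
      \<comment> \<open>The offset of the half that can receive colours of \<open>S\<close> from
        \<open>x\<close>: the condition on \<open>p x\<close> and \<open>p y\<close> says that
        \<open>p y\<close> holds exactly when \<open>p x = (1 \<in> S)\<close>.\<close>
      define b where "b = (if p x = (1 \<in> S) then 0 else m)"
      have "{y \<in> {..<n}. x \<noteq> y \<and> f {x, y} \<in> S} \<subseteq> {2 * m * j + b..<2 * m * j + b + m}"
      proof
        fix y assume "y \<in> {y \<in> {..<n}. x \<noteq> y \<and> f {x, y} \<in> S}"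
        then have y: "S \<union> c y = {1..2 * s}" "p x = p y \<longleftrightarrow> 1 \<in> S"
          using f_c[of x y] cx by auto
        have "card S + card (c y) = 2 * s + card (S \<inter> c y)"
          using card_Un_Int[OF finS fin_c, of y] y(1) by simp
        then have "S \<inter> c y = {}" using card_S c(2)[of y] finS by simp
        then have cy: "c y = {1..2 * s} - S" using y(1) by blast
        \<comment> \<open>Nonemptiness shows that \<open>y\<close> lies in a block and is not a
          leftover vertex.\<close>
        have "c y \<noteq> {}" unfolding cy using Sc s by (auto simp only: nsets_def card.empty)
        then have "y div (2 * m) < ?C" "h (y div (2 * m)) = h j"
          using cy j(2) unfolding c_def by presburger+
        then have "y div (2 * m) = j" using h(1) j(1) by (auto dest: inj_onD)
        then have "y = 2 * m * j + y mod (2 * m)" by (metis mult_div_mod_eq)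
        moreover have "y mod (2 * m) < 2 * m" using m by simp
        moreover have "b = (if y mod (2 * m) < m then 0 else m)"
          using y(2) unfolding b_def p_def by argo
        ultimately show "y \<in> {2 * m * j + b..<2 * m * j + b + m}"
          unfolding atLeastLessThan_iff
          by (cases "y mod (2 * m) < m"; simp only: if_True if_False; linarith)
      qed
      then have "card {y \<in> {..<n}. x \<noteq> y \<and> f {x, y} \<in> S}
          \<le> card {2 * m * j + b..<2 * m * j + b + m}"
        by (intro card_mono) auto
      then show "card {y \<in> {..<n}. x \<noteq> y \<and> f {x, y} \<in> S} < Suc m" by simp
    qed
  qed simp
  then show ?thesis using min_max_k_conn_le[OF f] order_trans by blast
qed

text \<open>Two \<open>s\<close>-sets never cover more than \<open>2 * s\<close> colours, so every
  edge can avoid the sets of both ends. Classes are residues modulo \<open>r choose s\<close>, and a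
  vertex of the class of \<open>S\<close> has no edge at all in the colours of
  \<open>S\<close>.\<close>

lemma min_max_k_conn_gt_two_s_le:
  assumes s: "1 \<le> s" "2 * s < r" and k: "1 \<le> k"
  shows "min_max_k_conn n r s k \<le> n - n div (r choose s)"
proof -
  let ?C = "r choose s"
  have C: "0 < ?C" using s by simp
  obtain h where h: "inj_on h {..<?C}" "\<And>i. i < ?C \<Longrightarrow> h i \<in> nsets {1..r} s"
    "\<And>S. S \<in> nsets {1..r} s \<Longrightarrow> \<exists>i < ?C. h i = S"
    by (rule obtain_nsets_enumeration) blast
  define c where "c v = h (v mod ?C)" for v
  have c: "c v \<subseteq> {1..r}" "card (c v) = s" for v
    using h(2)[of "v mod ?C"] C by (auto simp: c_def nsets_def)
  have c_Un: "c x \<union> c y \<noteq> {1..r}" for x y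
    using card_Un_le[of "c x" "c y"] c(2) s(2) by auto
  obtain f where f: "f \<in> colourings n r"
    and f_c: "\<And>x y. x \<noteq> y \<Longrightarrow> f {x, y} \<notin> c x"
    using avoiding_colouring_exists[of s r c n] s c c_Un by (metis less_imp_le order_refl)
  have "max_k_conn f n s k \<le> n - n div ?C"
  proof (rule max_k_conn_le_if_low_degree[OF f])
    fix S assume "S \<in> nsets {1..r} s"
    then obtain i where i: "i < ?C" "h i = S" using h(3) by blast
    \<comment> \<open>The first \<open>n div ?C\<close> members of the residue class of
      \<open>i\<close>; all of them are below \<open>n\<close>.\<close>
    let ?X = "(\<lambda>j. ?C * j + i) ` {..<n div ?C}"
    show "\<exists>X \<subseteq> {..<n}. n div ?C \<le> card X \<and>
      (\<forall>x \<in> X. card {y \<in> {..<n}. x \<noteq> y \<and> f {x, y} \<in> S} < k)"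
    proof (intro exI[of _ ?X] conjI ballI)
      show "?X \<subseteq> {..<n}"
      proof clarsimp
        fix j assume "j < n div ?C"
        then have "?C * (j + 1) \<le> ?C * (n div ?C)" by (intro mult_left_mono) auto
        also have "\<dots> \<le> n" by simp
        finally show "?C * j + i < n" using i(1) by simp
      qed
      show "n div ?C \<le> card ?X"
        using C by (subst card_image) (auto simp: inj_on_def)
      fix x assume "x \<in> ?X"
      then have "c x = S" using i by (auto simp: c_def)
      then have none: "{y \<in> {..<n}. x \<noteq> y \<and> f {x, y} \<in> S} = {}" using f_c by auto
      show "card {y \<in> {..<n}. x \<noteq> y \<and> f {x, y} \<in> S} < k" unfolding none using k by simp
    qed
  qed (use s in simp)
  then show ?thesis using min_max_k_conn_le[OF f] order_trans by blast
qed

section \<open>Combining the bounds\<close>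

lemma min_max_k_conn_attained:
  assumes "1 \<le> r"
  obtains f where "f \<in> colourings n r" "min_max_k_conn n r s k = max_k_conn f n s k"
  using Min_in[OF finite_max_k_conn_image[of n s k r]] colourings_nonempty[OF assms, of n] that
  unfolding min_max_k_conn_def by auto

theorem theorem1p3:
  "(\<forall>n s k :: nat. 2 \<le> n \<longrightarrow> 1 \<le> s \<longrightarrow> 1 \<le> k \<longrightarrow>
      int n \<ge> max (2 * int ((2 * s) choose s) * (int k - 1) + 1) (13 * int k - 15) \<longrightarrow>
      int (min_max_k_conn n (2 * s) s k) = int n - 2 * int k + 2) \<and>
   (\<forall>s r :: nat. 1 \<le> s \<longrightarrow> 2 * s < r \<longrightarrow>
      (\<exists>\<epsilon>::real. \<epsilon> > 0 \<and>
        (\<forall>k::nat. 1 \<le> k \<longrightarrow>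
          (\<forall>\<^sub>F n in sequentially. real (min_max_k_conn n r s k) < (1 - \<epsilon>) * real n))))"
proof (intro conjI allI impI)
  fix n s k :: nat
  assume n: "2 \<le> n" and s: "1 \<le> s" and k: "1 \<le> k"
    and large: "int n \<ge> max (2 * int ((2 * s) choose s) * (int k - 1) + 1) (13 * int k - 15)"
  obtain m where m: "k = Suc m" using k by (cases k) auto
  have n_binom: "2 * m * ((2 * s) choose s) \<le> n"
  proof -
    have "int (2 * m * ((2 * s) choose s)) \<le> int n" using large m by (simp add: algebra_simps)
    then show ?thesis by linarith
  qed
  \<comment> \<open>In terms of \<open>m\<close>, \<open>13 * k - 15\<close> is
    \<open>13 * m - 2\<close>, which exceeds \<open>8 * m\<close> and is at least
    \<open>m + 2\<close> when \<open>m > 0\<close>. For \<open>m = 0\<close> the claims follow from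
    \<open>2 \<le> n\<close>.\<close>
  have n_m: "m + 2 \<le> n" "8 * m < n" using large m n by (cases "m = 0"; auto)+
  obtain f where f: "f \<in> colourings n (2 * s)"
    and min: "min_max_k_conn n (2 * s) s k = max_k_conn f n s k"
    using min_max_k_conn_attained[of "2 * s" n s k] s by auto
  have "n \<le> min_max_k_conn n (2 * s) s k + 2 * m"
    using max_k_conn_two_s_ge[OF f n_m] min m by simp
  moreover have "min_max_k_conn n (2 * s) s k \<le> n - 2 * m"
  \<comment> \<open>Blocks of \<open>2 * m\<close> vertices make sense only for
    \<open>m > 0\<close>; for \<open>m = 0\<close> the claim is the trivial bound by
    \<open>n\<close>.\<close>
  proof (cases "m = 0")
    case True
    then show ?thesis unfolding min using max_k_conn_le by simp
  next
    case False
    then show ?thesis unfolding m using s n_binom by (intro min_max_k_conn_two_s_le) auto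
  qed
  ultimately show "int (min_max_k_conn n (2 * s) s k) = int n - 2 * int k + 2"
    using n_m m by linarith
next
  fix s r :: nat
  assume s: "1 \<le> s" "2 * s < r"
  define C where "C = r choose s"
  have C: "0 < C" using s by (simp add: C_def)
  show "\<exists>\<epsilon>::real. \<epsilon> > 0 \<and> (\<forall>k::nat. 1 \<le> k \<longrightarrow>
    (\<forall>\<^sub>F n in sequentially. real (min_max_k_conn n r s k) < (1 - \<epsilon>) * real n))"
  \<comment> \<open>The loss \<open>n div C\<close> exceeds \<open>n / C - 1\<close>, hence exceeds
    \<open>n / (2 * C)\<close> once \<open>n > 2 * C\<close>: halving \<open>1 / C\<close> absorbs
    the rounding and gives strict inequality. The choice does not depend on
    \<open>k\<close>.\<close>
  proof (intro exI[of _ "1 / (2 * real C)"] conjI allI impI)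
    fix k :: nat assume k: "1 \<le> k"
    show "\<forall>\<^sub>F n in sequentially. real (min_max_k_conn n r s k) < (1 - 1 / (2 * real C)) * real n"
      using eventually_gt_at_top[of "2 * C"]
    proof eventually_elim
      case (elim n)
      have "n < C * (n div C) + C"
        using C mod_less_divisor[of C n] mult_div_mod_eq[of C n] by linarith
      then have "real n < real C * real (n div C) + real C"
        by (simp flip: of_nat_mult of_nat_add)
      then have "real n / real C < real (n div C) + 1"
        using C by (simp add: field_simps)
      moreover have "1 < real n / (2 * real C)"
        using elim C by (simp add: field_simps flip: of_nat_mult)
      ultimately have "real n / (2 * real C) < real (n div C)"
        by (simp add: field_simps)
      moreover have "real (min_max_k_conn n r s k) \<le> real n - real (n div C)"
        using min_max_k_conn_gt_two_s_le[OF s k, of n] by (simp add: C_def flip: of_nat_diff)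
      ultimately show ?case by (simp add: algebra_simps)
    qed
  qed (use C in simp)
qed

end
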